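(* Let $n\ge 2$ and let $\Omega\subsetneq\mathbb{R}^n$ be a domain. Let $u$ be a nonnegative quasi-nearly subharmonic function on $\Omega$. If $\psi:\mathbb{R}_+\to\mathbb{R}_+$ is a permissible function, then $\psi\circ u$ is quasi-nearly subharmonic on $\Omega$.
   Context: Here $\mathbb{R}_+=[0,\infty)$, $m$ is Lebesgue measure on $\mathbb{R}^n$, and $B(x,r)$ is the Euclidean ball with center $x$ and radius $r$. Quasi-nearly subharmonic: a Lebesgue measurable function $u:\Omega\to[-\infty,\infty]$ is quasi-nearly subharmonic on $\Omega$ if $u\in\mathcal{L}^1_{\mathrm{loc}}(\Omega)$ (locally integrable on $\Omega$) and there is a constant $C_0=C_0(n,u,\Omega)\ge 1$ such that $$u(x)\le \frac{C_0}{r^n}\int_{B(x,r)}u(y)\,dm(y)$$ for every ball $B(x,r)\subset\Omega$. $\varDelta_2$-condition: a function $f:\mathbb{R}_+\to\mathbb{R}_+$ satisfies the $\varDelta_2$-condition if there is a constant $C=C(f)\ge1$ with $f(2t)\le C f(t)$ for all $t\in\mathbb{R}_+$. Permissible: a function $\psi:\mathbb{R}_+\to\mathbb{R}_+$ is permissible if there are a nondecreasing convex function $\psi_1:\mathbb{R}_+\to\mathbb{R}_+$ and a (strictly) increasing surjection $\psi_2:\mathbb{R}_+\to\mathbb{R}_+$ with $\psi=\psi_2\circ\psi_1$ such that: (a) $\psi_1$ satisfies the $\varDelta_2$-condition; (b) $\psi_2^{-1}$ satisfies the $\varDelta_2$-condition; (c) the function $t\mapsto t/\psi_2(t)$ is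 quasi-increasing, i.e. there is a constant $C=C(\psi_2)\ge1$ such that $\frac{s}{\psi_2(s)}\le C\,\frac{t}{\psi_2(t)}$ for all $0<s\le t$. *)

theory Defs
  imports "HOL-Analysis.Analysis"
begin

text \<open>
  Functions on a set \<open>\<Omega>\<close> or on the half-line \<open>{0..}\<close> are total functions whose values elsewhere
  are never used.
\<close>

text \<open>
  The Lebesgue integral of an extended real-valued function: positive part minus negative part,
  where \<open>e2ennreal\<close> maps negative values to \<open>0\<close>. If both parts are infinite, the integral is
  undefined in mathematics; here it is \<open>\<infinity>\<close>, since \<open>\<infinity> - \<infinity> = \<infinity>\<close> in \<open>ereal\<close>, so
  that the inequality below is not a requirement on such a ball.
\<close>

definition integral_over :: "(real^'n) set \<Rightarrow> (real^'n \<Rightarrow> ereal) \<Rightarrow> ereal" where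
  "integral_over A u =
     enn2ereal (\<integral>\<^sup>+ y\<in>A. e2ennreal (u y) \<partial>lebesgue) -
     enn2ereal (\<integral>\<^sup>+ y\<in>A. e2ennreal (- u y) \<partial>lebesgue)"

definition locally_integrable_on :: "(real^'n \<Rightarrow> ereal) \<Rightarrow> (real^'n) set \<Rightarrow> bool" where
  "locally_integrable_on u \<Omega> \<longleftrightarrow>
     u \<in> borel_measurable (lebesgue_on \<Omega>) \<and>
     (\<forall>K. compact K \<and> K \<subseteq> \<Omega> \<longrightarrow> (\<integral>\<^sup>+ y\<in>K. e2ennreal \<bar>u y\<bar> \<partial>lebesgue) < \<infinity>)"

definition quasi_nearly_subharmonic_on :: "(real^'n \<Rightarrow> ereal) \<Rightarrow> (real^'n) set \<Rightarrow> bool" where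
  "quasi_nearly_subharmonic_on u \<Omega> \<longleftrightarrow>
     u \<in> borel_measurable (lebesgue_on \<Omega>) \<and>
     locally_integrable_on u \<Omega> \<and>
     (\<exists>C\<^sub>0::real. C\<^sub>0 \<ge> 1 \<and>
        (\<forall>x r. r > 0 \<and> ball x r \<subseteq> \<Omega> \<longrightarrow>
           u x \<le> ereal (C\<^sub>0 / r ^ CARD('n)) * integral_over (ball x r) u))"

definition Delta2_condition :: "(real \<Rightarrow> real) \<Rightarrow> bool" where
  "Delta2_condition f \<longleftrightarrow> (\<exists>C\<ge>1. \<forall>t\<ge>0. f (2 * t) \<le> C * f t)"

definition quasi_increasing :: "(real \<Rightarrow> real) \<Rightarrow> bool" where
  "quasi_increasing g \<longleftrightarrow> (\<exists>C\<ge>1. \<forall>s t. 0 < s \<and> s \<le> t \<longrightarrow> g s \<le> C * g t)"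

definition permissible :: "(real \<Rightarrow> real) \<Rightarrow> bool" where
  "permissible \<psi> \<longleftrightarrow>
     (\<exists>\<psi>\<^sub>1 \<psi>\<^sub>2.
        \<psi>\<^sub>1 \<in> {0..} \<rightarrow> {0..} \<and> mono_on {0..} \<psi>\<^sub>1 \<and> convex_on {0..} \<psi>\<^sub>1 \<and>
        strict_mono_on {0..} \<psi>\<^sub>2 \<and> \<psi>\<^sub>2 ` {0..} = {0..} \<and>
        (\<forall>t\<ge>0. \<psi> t = \<psi>\<^sub>2 (\<psi>\<^sub>1 t)) \<and>
        Delta2_condition \<psi>\<^sub>1 \<and>
        Delta2_condition (inv_into {0..} \<psi>\<^sub>2) \<and>
        quasi_increasing (\<lambda>t. t / \<psi>\<^sub>2 t))"

text \<open>
  A quasi-nearly subharmonic function on an open set is nowhere \<open>\<infinity>\<close>. A nonnegative one is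
  therefore finite, and composing it with a real function via \<open>real_of_ereal\<close> loses nothing.
\<close>

lemma quasi_nearly_subharmonic_on_finite:
  fixes u :: "real^'n \<Rightarrow> ereal"
  assumes u: "quasi_nearly_subharmonic_on u \<Omega>" and "open \<Omega>" and "x \<in> \<Omega>"
  shows "u x < \<infinity>"
proof -
  obtain r where r: "r > 0" "cball x r \<subseteq> \<Omega>"
    using \<open>open \<Omega>\<close> \<open>x \<in> \<Omega>\<close> open_contains_cball by blast
  then have "ball x r \<subseteq> \<Omega>"
    using ball_subset_cball[of x r] by blast
  with u r obtain C where C: "u x \<le> ereal (C / r ^ CARD('n)) * integral_over (ball x r) u"
    and "C \<ge> 1"
    unfolding quasi_nearly_subharmonic_on_def by blast
  define I where "I = (\<integral>\<^sup>+ y\<in>ball x r. e2ennreal (u y) \<partial>lebesgue)"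
  define J where "J = (\<integral>\<^sup>+ y\<in>ball x r. e2ennreal (- u y) \<partial>lebesgue)"
  have abs: "e2ennreal (u y) \<le> e2ennreal \<bar>u y\<bar>" for y
    by (intro e2ennreal_mono) (cases "u y"; simp)
  have "I \<le> (\<integral>\<^sup>+ y\<in>cball x r. e2ennreal \<bar>u y\<bar> \<partial>lebesgue)"
    unfolding I_def by (intro nn_integral_mono) (auto simp: indicator_def abs)
  also have "\<dots> < \<infinity>"
    using u r unfolding quasi_nearly_subharmonic_on_def locally_integrable_on_def by auto
  finally have "enn2ereal I < \<infinity>"
    by (cases I) auto
  moreover have "enn2ereal J \<ge> 0" by simp
  ultimately have "integral_over (ball x r) u < \<infinity>"
    unfolding integral_over_def I_def[symmetric] J_def[symmetric]
    by (cases "enn2ereal I"; cases "enn2ereal J") auto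
  moreover have "C / r ^ CARD('n) > 0" using \<open>C \<ge> 1\<close> r by simp
  ultimately have "ereal (C / r ^ CARD('n)) * integral_over (ball x r) u < \<infinity>"
    by (cases "integral_over (ball x r) u") auto
  with C show ?thesis by (rule le_less_trans)
qed

end

theory Submission
  imports Defs
begin

text \<open>
  Write \<open>\<psi> = \<psi>\<^sub>2 \<circ> \<psi>\<^sub>1\<close>. Halving radii, it suffices to treat balls whose closure lies in \<open>\<Omega>\<close>; there
  \<open>u\<close> is bounded, because its local integrability and mean value inequality make it locally
  bounded. Jensen's inequality and \<open>\<Delta>\<^sub>2\<close> give the mean value inequality for \<open>v = \<psi>\<^sub>1 \<circ> u\<close>. For
  \<open>w = \<psi>\<^sub>2 \<circ> v\<close>, let \<open>y\<close> almost maximise \<open>w y * (R - dist x y) ^ n\<close> on \<open>B(x,R)\<close> and put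
  \<open>s = (R - dist x y) / 2\<close>. On \<open>B(y,s)\<close> we have \<open>w \<le> 2 ^ (n + 1) * w y\<close>, hence \<open>v \<le> K * v y\<close> by
  \<open>\<Delta>\<^sub>2\<close> for \<open>\<psi>\<^sub>2\<inverse>\<close>, hence \<open>v \<le> L * K * (v y / w y) * w\<close> since \<open>t / \<psi>\<^sub>2 t\<close> is quasi-increasing.
  Inserting this in the mean value inequality for \<open>v\<close> on \<open>B(y,s)\<close> bounds \<open>w y * s ^ n\<close>, and thus
  \<open>w x * R ^ n\<close>, by the integral of \<open>w\<close>.
\<close>

lemma Delta2_iterate:
  assumes "\<forall>t\<ge>0. f (2 * t) \<le> C * f t" and "C \<ge> 0" and "(t::real) \<ge> 0"
  shows "f (2 ^ k * t) \<le> C ^ k * (f t :: real)"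
proof (induction k)
  case (Suc k)
  have "f (2 ^ Suc k * t) = f (2 * (2 ^ k * t))" by (simp add: mult.assoc)
  also have "\<dots> \<le> C * f (2 ^ k * t)" using assms(1,3) by simp
  also have "\<dots> \<le> C * (C ^ k * f t)" using Suc assms(2) by (rule mult_left_mono)
  finally show ?case by (simp add: mult.assoc)
qed simp

text \<open>Nothing is known about \<open>g\<close> off \<open>A\<close>, so \<open>f\<close> is
  viewed as a map into \<open>restrict_space borel A\<close>, where a monotone \<open>g\<close> is
  Borel.\<close>

lemma measurable_comp_mono_on:
  fixes g :: "real \<Rightarrow> real"
  assumes "mono_on A g" and "f \<in> borel_measurable M" and "\<And>x. x \<in> space M \<Longrightarrow> f x \<in> A"
  shows "(\<lambda>x. g (f x)) \<in> borel_measurable M"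
proof (rule measurable_compose[of f M "restrict_space borel A"])
  show "f \<in> measurable M (restrict_space borel A)"
    using assms by (intro measurable_restrict_space2) auto
  show "g \<in> borel_measurable (restrict_space borel A)"
    using assms by (intro borel_measurable_mono_on_fnc)
qed

section \<open>Jensen's inequality for nondecreasing convex functions on the half-line\<close>

text \<open>At an interior point \<open>a\<close> the right derivative is a slope of support, and
  comparing with the value at 0 shows that it is nonnegative. At the endpoint \<open>a = 0\<close>
  monotonicity allows slope 0. Both sides are arranged as sums of nonnegative terms when
  \<open>\<phi>\<close> is nonnegative, ready for \<open>ennreal\<close>.\<close>

lemma convex_mono_supporting_line:
  fixes \<phi> :: "real \<Rightarrow> real"
  assumes "mono_on {0..} \<phi>" and "convex_on {0..} \<phi>" and "a \<ge> 0"
  obtains c where "c \<ge> 0" and "\<And>t. t \<ge> 0 \<Longrightarrow> \<phi> a + c * t \<le> \<phi> t + c * a"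
proof (cases "a = 0")
  case True
  then show ?thesis
    using assms that[of 0] by (auto simp: mono_on_def)
next
  case False
  \<comment> \<open>The infimum of the difference quotients to the right of \<open>a\<close>, that
    is, the right derivative there.\<close>
  define c where "c = Inf ((\<lambda>t. (\<phi> a - \<phi> t) / (a - t)) ` ({a<..} \<inter> {0..}))"
  have line: "\<phi> t \<ge> \<phi> a + c * (t - a)" if "t \<ge> 0" for t
    unfolding c_def using assms False that by (intro convex_le_Inf_differential) auto
  have "\<phi> 0 \<le> \<phi> a" using assms by (auto simp: mono_on_def)
  with line[of 0] have "0 \<le> c * a" by simp
  then have "c \<ge> 0" using False assms(3) by (simp add: zero_le_mult_iff)
  then show ?thesis using line that[of c] by (auto simp: algebra_simps)
qed

text \<open>Integrate the supporting line at the mean value \<open>a\<close> of \<open>f\<close>.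
  The total mass is left unnormalised, and the right-hand integral may be infinite.\<close>

lemma nn_integral_jensen:
  fixes \<phi> :: "real \<Rightarrow> real"
  assumes "finite_measure M"
    and mono: "mono_on {0..} \<phi>" and "convex_on {0..} \<phi>" and nonneg: "\<And>t. t \<ge> 0 \<Longrightarrow> \<phi> t \<ge> 0"
    and f: "f \<in> borel_measurable M" "\<And>x. x \<in> space M \<Longrightarrow> f x \<ge> 0"
    and a: "a \<ge> 0" "(\<integral>\<^sup>+ x. ennreal (f x) \<partial>M) = ennreal (a * measure M (space M))"
  shows "ennreal (\<phi> a * measure M (space M)) \<le> (\<integral>\<^sup>+ x. ennreal (\<phi> (f x)) \<partial>M)"
proof -
  interpret finite_measure M by fact
  define m where "m = measure M (space M)"
  have m: "m \<ge> 0" "emeasure M (space M) = ennreal m"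
    by (auto simp: m_def emeasure_eq_measure)
  obtain c where c: "c \<ge> 0" and line: "\<And>t. t \<ge> 0 \<Longrightarrow> \<phi> a + c * t \<le> \<phi> t + c * a"
    using convex_mono_supporting_line[OF mono assms(3) a(1)] by blast
  have \<phi>f: "(\<lambda>x. \<phi> (f x)) \<in> borel_measurable M"
    by (rule measurable_comp_mono_on[OF mono f(1)]) (simp add: f)
  \<comment> \<open>The linear term stays on both sides as an added quantity; being finite, it
    cancels at the end without any subtraction in \<open>ennreal\<close>.\<close>
  have "ennreal (\<phi> a * m) + ennreal (c * a * m)
      = (\<integral>\<^sup>+ x. ennreal (\<phi> a) + ennreal c * ennreal (f x) \<partial>M)"
    using f a m c nonneg[OF a(1)]
    by (simp add: nn_integral_add nn_integral_cmult m_def[symmetric] ennreal_mult mult.assoc)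
  also have "\<dots> \<le> (\<integral>\<^sup>+ x. ennreal (\<phi> (f x)) + ennreal (c * a) \<partial>M)"
  proof (rule nn_integral_mono)
    fix x assume "x \<in> space M"
    then have "f x \<ge> 0" by (rule f)
    then show "ennreal (\<phi> a) + ennreal c * ennreal (f x) \<le> ennreal (\<phi> (f x)) + ennreal (c * a)"
      using line[of "f x"] c nonneg a
      by (simp add: ennreal_mult[symmetric] ennreal_plus[symmetric] del: ennreal_plus)
  qed
  also have "\<dots> = (\<integral>\<^sup>+ x. ennreal (\<phi> (f x)) \<partial>M) + ennreal (c * a * m)"
    using \<phi>f a m c by (simp add: nn_integral_add ennreal_mult)
  finally show ?thesis
    unfolding m_def by simp
qed

section \<open>Mean value inequalities for real functions and local boundedness\<close>

text \<open>The quasi-nearly subharmonic inequality cleared of its denominator, so that nonnegative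
  functions can be handled in \<open>ennreal\<close> throughout, even when the integral is
  infinite.\<close>

definition mean_value_bound :: "real \<Rightarrow> ('a::euclidean_space \<Rightarrow> real) \<Rightarrow> 'a set \<Rightarrow> bool" where
  "mean_value_bound C f \<Omega> \<longleftrightarrow>
     (\<forall>x r. r > 0 \<and> ball x r \<subseteq> \<Omega> \<longrightarrow>
        ennreal (f x * r ^ DIM('a)) \<le> ennreal C * (\<integral>\<^sup>+ y. ennreal (f y) \<partial>lebesgue_on (ball x r)))"

lemma nn_integral_lebesgue_on_mono:
  assumes "A \<subseteq> B" and "A \<in> sets lebesgue" and "B \<in> sets lebesgue"
  shows "(\<integral>\<^sup>+ y. f y \<partial>lebesgue_on A) \<le> (\<integral>\<^sup>+ y. f y \<partial>lebesgue_on B)"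
  using assms by (auto simp: nn_integral_restrict_space indicator_def intro!: nn_integral_mono)

text \<open>Apply the hypothesis to the concentric ball of half the radius, whose closure lies in
  \<open>\<Omega>\<close>; rescaling the radius costs \<open>2 ^ DIM('a)\<close>. This gives access
  to bounds that hold only on compact sets.\<close>

lemma mean_value_bound_if_cball:
  fixes f :: "'a::euclidean_space \<Rightarrow> real"
  assumes "\<And>x r. r > 0 \<Longrightarrow> cball x r \<subseteq> \<Omega> \<Longrightarrow>
      ennreal (f x * r ^ DIM('a)) \<le> ennreal C * (\<integral>\<^sup>+ y. ennreal (f y) \<partial>lebesgue_on (ball x r))"
    and "C \<ge> 0"
  shows "mean_value_bound (2 ^ DIM('a) * C) f \<Omega>"
  unfolding mean_value_bound_def
proof (intro allI impI, elim conjE)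
  fix x :: 'a and r :: real
  assume r: "r > 0" "ball x r \<subseteq> \<Omega>"
  then have "cball x (r/2) \<subseteq> \<Omega>" by (force simp: subset_iff)
  with r have "ennreal (f x * (r/2) ^ DIM('a))
      \<le> ennreal C * (\<integral>\<^sup>+ y. ennreal (f y) \<partial>lebesgue_on (ball x (r/2)))"
    by (intro assms(1)) auto
  also have "\<dots> \<le> ennreal C * (\<integral>\<^sup>+ y. ennreal (f y) \<partial>lebesgue_on (ball x r))"
    using r by (intro mult_left_mono nn_integral_lebesgue_on_mono) auto
  finally have "ennreal (2 ^ DIM('a)) * ennreal (f x * (r/2) ^ DIM('a))
      \<le> ennreal (2 ^ DIM('a)) * (ennreal C * (\<integral>\<^sup>+ y. ennreal (f y) \<partial>lebesgue_on (ball x r)))"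
    by (rule mult_left_mono) simp
  moreover have "ennreal (2 ^ DIM('a)) * ennreal (f x * (r/2) ^ DIM('a)) = ennreal (f x * r ^ DIM('a))"
    by (subst ennreal_mult'[symmetric]) (auto simp: power_divide)
  moreover have "ennreal (2 ^ DIM('a) * C) = ennreal (2 ^ DIM('a)) * ennreal C"
    by (rule ennreal_mult') simp
  ultimately show "ennreal (f x * r ^ DIM('a))
      \<le> ennreal (2 ^ DIM('a) * C) * (\<integral>\<^sup>+ y. ennreal (f y) \<partial>lebesgue_on (ball x r))"
    by (simp add: mult.assoc)
qed

text \<open>Balls of one common radius about the points of \<open>K\<close> stay in a single compact
  subset of \<open>\<Omega>\<close>, whose finite integral controls every mean value.\<close>

lemma mean_value_bound_locally_bounded:
  fixes f :: "'a::euclidean_space \<Rightarrow> real"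
  assumes "open \<Omega>" and "mean_value_bound C f \<Omega>"
    and int: "\<And>K. compact K \<Longrightarrow> K \<subseteq> \<Omega> \<Longrightarrow> (\<integral>\<^sup>+ y. ennreal (f y) \<partial>lebesgue_on K) < \<infinity>"
    and K: "compact K" "K \<subseteq> \<Omega>"
  shows "bdd_above (f ` K)"
proof -
  obtain e where e: "e > 0" "(\<Union>x\<in>K. cball x e) \<subseteq> \<Omega>"
    using compact_subset_open_imp_cball_epsilon_subset[OF K(1) assms(1) K(2)] .
  \<comment> \<open>The closed \<open>e\<close>-neighbourhood of \<open>K\<close>, written as a sum
    of two compact sets so that its compactness is immediate.\<close>
  define L where "L = {x + y |x y. x \<in> K \<and> y \<in> cball 0 e}"
  have cball_L: "cball x e \<subseteq> L" if "x \<in> K" for x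
  proof
    fix z assume "z \<in> cball x e"
    then have "z = x + (z - x)" "z - x \<in> cball 0 e" by (auto simp: dist_norm norm_minus_commute)
    with that show "z \<in> L" unfolding L_def by blast
  qed
  have "L \<subseteq> \<Omega>" using e unfolding L_def by (force simp: dist_norm)
  have "compact L" unfolding L_def using K by (intro compact_sums) auto
  define I where "I = (\<integral>\<^sup>+ y. ennreal (f y) \<partial>lebesgue_on L)"
  have "I < \<infinity>" unfolding I_def using \<open>compact L\<close> \<open>L \<subseteq> \<Omega>\<close> by (rule int)
  then have "ennreal C * I < \<infinity>" by (simp add: ennreal_mult_less_top)
  then obtain b where b: "b \<ge> 0" "ennreal C * I = ennreal b"
    by (cases "ennreal C * I") auto
  have "f x \<le> b / e ^ DIM('a)" if "x \<in> K" for x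
  proof -
    have ball: "ball x e \<subseteq> L" using cball_L[OF that] ball_subset_cball by blast
    then have "ennreal (f x * e ^ DIM('a))
        \<le> ennreal C * (\<integral>\<^sup>+ y. ennreal (f y) \<partial>lebesgue_on (ball x e))"
      using assms(2) e \<open>L \<subseteq> \<Omega>\<close> unfolding mean_value_bound_def by blast
    also have "\<dots> \<le> ennreal C * I"
      unfolding I_def using ball \<open>compact L\<close>
      by (intro mult_left_mono nn_integral_lebesgue_on_mono)
         (auto intro: lmeasurable_compact fmeasurableD)
    finally have "f x * e ^ DIM('a) \<le> b" using b by simp
    then show ?thesis using e by (simp add: pos_le_divide_eq)
  qed
  then show ?thesis by (auto simp: bdd_above_def)
qed

section \<open>Composition with the convex function\<close>

text \<open>If \<open>a\<close> is the average of \<open>f\<close> over the ball, then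
  \<open>f x\<close> is at most a fixed multiple of \<open>a\<close>. The doubling condition pulls
  this multiple out of \<open>\<phi>\<close>, and Jensen's inequality bounds \<open>\<phi> a\<close>
  by the average of \<open>\<phi> (f y)\<close>.\<close>

lemma mean_value_bound_convex:
  fixes f :: "'a::euclidean_space \<Rightarrow> real"
  assumes f: "f \<in> borel_measurable (lebesgue_on \<Omega>)" "\<And>x. x \<in> \<Omega> \<Longrightarrow> f x \<ge> 0"
    and bdd: "\<And>K. compact K \<Longrightarrow> K \<subseteq> \<Omega> \<Longrightarrow> bdd_above (f ` K)"
    and mvb: "mean_value_bound C f \<Omega>" and "C \<ge> 0"
    and \<phi>: "\<phi> \<in> {0..} \<rightarrow> {0..}" "mono_on {0..} \<phi>" "convex_on {0..} \<phi>" "Delta2_condition \<phi>"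
  obtains C' where "C' \<ge> 0" and "mean_value_bound C' (\<lambda>x. \<phi> (f x)) \<Omega>"
proof -
  define \<nu> where "\<nu> = unit_ball_vol (real DIM('a))"
  have \<nu>: "\<nu> > 0" by (simp add: \<nu>_def)
  obtain D where D: "D \<ge> 1" "\<forall>t\<ge>0. \<phi> (2 * t) \<le> D * \<phi> t"
    using \<phi>(4) unfolding Delta2_condition_def by blast
  \<comment> \<open>Passing from the integral to the average brings in the unit ball volume, so
    \<open>f x\<close> is at most \<open>C * \<nu>\<close> times the average; \<open>k\<close>
    doublings cover this factor.\<close>
  obtain k :: nat where k: "C * \<nu> < 2 ^ k"
    using real_arch_pow[of 2 "C * \<nu>"] by auto
  have "mean_value_bound (2 ^ DIM('a) * (D ^ k / \<nu>)) (\<lambda>x. \<phi> (f x)) \<Omega>"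
  proof (rule mean_value_bound_if_cball)
    fix x :: 'a and r :: real
    assume r: "r > 0" "cball x r \<subseteq> \<Omega>"
    then have sub: "ball x r \<subseteq> \<Omega>" using ball_subset_cball by blast
    define M where "M = lebesgue_on (ball x r)"
    have sp: "space M = ball x r" by (simp add: M_def)
    define m where "m = \<nu> * r ^ DIM('a)"
    have m: "m > 0" using \<nu> r by (simp add: m_def)
    have em: "emeasure M (space M) = ennreal m"
      using r unfolding sp unfolding M_def
      by (subst emeasure_restrict_space) (auto simp: emeasure_ball m_def \<nu>_def)
    then have fin: "finite_measure M" by (intro finite_measureI) simp
    have mm: "measure M (space M) = m" using em m by (simp add: measure_def)
    have fM: "f \<in> borel_measurable M" "\<And>y. y \<in> space M \<Longrightarrow> f y \<ge> 0"
      using f sub unfolding sp unfolding M_def by (auto intro: measurable_restrict_mono)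
    obtain b where b: "\<And>y. y \<in> cball x r \<Longrightarrow> f y \<le> b"
      using bdd[OF compact_cball r(2)] unfolding bdd_above_def by blast
    \<comment> \<open>Boundedness on the closed ball makes the integral finite, so that the average
      is a real number.\<close>
    have "(\<integral>\<^sup>+ y. ennreal (f y) \<partial>M) \<le> (\<integral>\<^sup>+ y. ennreal b \<partial>M)"
      using b by (intro nn_integral_mono ennreal_leI) (auto simp: sp)
    also have "\<dots> < \<infinity>" by (simp add: em ennreal_mult_less_top)
    finally obtain I where I: "I \<ge> 0" "(\<integral>\<^sup>+ y. ennreal (f y) \<partial>M) = ennreal I"
      by (cases "\<integral>\<^sup>+ y. ennreal (f y) \<partial>M") auto
    define a where "a = I / m"
    have a: "a \<ge> 0" "I = a * m" using I m by (auto simp: a_def)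
    have jensen: "ennreal (\<phi> a * m) \<le> (\<integral>\<^sup>+ y. ennreal (\<phi> (f y)) \<partial>M)"
      using nn_integral_jensen[OF fin \<phi>(2,3) _ fM, of a] \<phi>(1) a I mm by auto
    have "x \<in> \<Omega>" using r by auto
    have "ennreal (f x * r ^ DIM('a)) \<le> ennreal C * ennreal I"
      using mvb r sub I unfolding mean_value_bound_def M_def by metis
    then have "f x * r ^ DIM('a) \<le> C * I"
      using \<open>C \<ge> 0\<close> I by (simp flip: ennreal_mult)
    also have "\<dots> = (C * \<nu> * a) * r ^ DIM('a)" by (simp add: a m_def)
    finally have "f x \<le> C * \<nu> * a" using r by simp
    also have "\<dots> \<le> 2 ^ k * a" using k a by (intro mult_right_mono) auto
    finally have "\<phi> (f x) \<le> \<phi> (2 ^ k * a)"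
      using \<phi>(2) f(2)[OF \<open>x \<in> \<Omega>\<close>] a by (auto simp: mono_on_def)
    also have "\<dots> \<le> D ^ k * \<phi> a" using D a by (intro Delta2_iterate) auto
    finally have "\<phi> (f x) * r ^ DIM('a) \<le> D ^ k * \<phi> a * r ^ DIM('a)"
      using r by (intro mult_right_mono) auto
    also have "\<dots> = D ^ k / \<nu> * (\<phi> a * m)" using \<nu> by (simp add: m_def)
    finally have "ennreal (\<phi> (f x) * r ^ DIM('a)) \<le> ennreal (D ^ k / \<nu> * (\<phi> a * m))"
      by (rule ennreal_leI)
    also have "\<dots> = ennreal (D ^ k / \<nu>) * ennreal (\<phi> a * m)"
      using D \<nu> by (intro ennreal_mult') auto
    also have "\<dots> \<le> ennreal (D ^ k / \<nu>) * (\<integral>\<^sup>+ y. ennreal (\<phi> (f y)) \<partial>M)"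
      using jensen by (rule mult_left_mono) simp
    finally show "ennreal (\<phi> (f x) * r ^ DIM('a))
        \<le> ennreal (D ^ k / \<nu>) * (\<integral>\<^sup>+ y. ennreal (\<phi> (f y)) \<partial>lebesgue_on (ball x r))"
      by (simp add: M_def)
  qed (use D \<nu> in auto)
  then show ?thesis by (rule that[rotated]) (use D \<nu> in auto)
qed

section \<open>Composition with the increasing surjection\<close>

text \<open>Apply the increasing inverse of \<open>g\<close> to the hypothesis on \<open>g b\<close>
  and double \<open>k\<close> times; \<open>K\<close> is the \<open>k\<close>-th power of the
  doubling constant.\<close>

lemma inverse_Delta2_bound:
  fixes g :: "real \<Rightarrow> real"
  assumes g: "strict_mono_on {0..} g" "g ` {0..} = {0..}"
    and "Delta2_condition (inv_into {0..} g)"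
  obtains K where "K \<ge> 1" and "\<And>a b. a \<ge> 0 \<Longrightarrow> b \<ge> 0 \<Longrightarrow> g b \<le> 2 ^ k * g a \<Longrightarrow> b \<le> K * a"
proof -
  let ?h = "inv_into {0..} g"
  obtain C where C: "C \<ge> 1" "\<forall>t\<ge>0. ?h (2 * t) \<le> C * ?h t"
    using assms(3) unfolding Delta2_condition_def by blast
  have inj: "inj_on g {0..}" using g(1) by (rule strict_mono_on_imp_inj_on)
  have h_g: "?h (g t) = t" if "t \<ge> 0" for t using inj that by simp
  have g_h: "?h s \<ge> 0" "g (?h s) = s" if "s \<ge> 0" for s
    using inv_into_into[of s g "{0..}"] f_inv_into_f[of s g "{0..}"] that g(2) by auto
  have h_mono: "?h s \<le> ?h t" if "0 \<le> s" "s \<le> t" for s t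
    using g_h[of s] g_h[of t] that strict_mono_onD[OF g(1), of "?h t" "?h s"]
    by (cases "?h t < ?h s") auto
  have "b \<le> C ^ k * a" if ab: "a \<ge> 0" "b \<ge> 0" "g b \<le> 2 ^ k * g a" for a b
  proof -
    have nn: "g a \<ge> 0" "g b \<ge> 0" using ab g(2) by auto
    have "b = ?h (g b)" using ab h_g by simp
    also have "\<dots> \<le> ?h (2 ^ k * g a)" using ab nn by (intro h_mono) auto
    also have "\<dots> \<le> C ^ k * ?h (g a)" using C nn by (intro Delta2_iterate) auto
    finally show ?thesis using ab h_g by simp
  qed
  moreover have "C ^ k \<ge> 1" using C by simp
  ultimately show ?thesis using that by blast
qed

lemma mean_value_bound_quasi_increasing:
  fixes f :: "'a::euclidean_space \<Rightarrow> real"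
  assumes f: "f \<in> borel_measurable (lebesgue_on \<Omega>)" "\<And>x. x \<in> \<Omega> \<Longrightarrow> f x \<ge> 0"
    and bdd: "\<And>K. compact K \<Longrightarrow> K \<subseteq> \<Omega> \<Longrightarrow> bdd_above (f ` K)"
    and mvb: "mean_value_bound C f \<Omega>" and "C \<ge> 0"
    and g: "strict_mono_on {0..} g" "g ` {0..} = {0..}" "Delta2_condition (inv_into {0..} g)"
      "quasi_increasing (\<lambda>t. t / g t)"
  obtains C' where "C' \<ge> 0" and "mean_value_bound C' (\<lambda>x. g (f x)) \<Omega>"
proof -
  let ?n = "DIM('a)"
  \<comment> \<open>In the exponent \<open>?n + 1\<close>, one factor 2 pays for choosing a point
    that only almost maximises, and \<open>2 ^ ?n\<close> for halving the distance to the
    boundary.\<close>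
  obtain K where K: "K \<ge> 1"
    "\<And>a b. a \<ge> 0 \<Longrightarrow> b \<ge> 0 \<Longrightarrow> g b \<le> 2 ^ (?n + 1) * g a \<Longrightarrow> b \<le> K * a"
    using inverse_Delta2_bound[OF g(1-3), of "?n + 1"] by blast
  obtain L where L: "L \<ge> 1" "\<And>s t. 0 < s \<Longrightarrow> s \<le> t \<Longrightarrow> s / g s \<le> L * (t / g t)"
    using g(4) unfolding quasi_increasing_def by blast
  have g_mono: "mono_on {0..} g" using g(1) by (rule strict_mono_on_imp_mono_on)
  have g_nonneg: "g t \<ge> 0" if "t \<ge> 0" for t using g(2) that by auto
  have g_pos: "g t > 0" if "t > 0" for t
    using strict_mono_onD[OF g(1), of 0 t] that g_nonneg[of 0] by simp
  \<comment> \<open>By surjectivity some point is sent to 0, and positivity of \<open>g\<close> on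
    positive arguments leaves only 0 itself.\<close>
  have g0: "g 0 = 0"
  proof -
    obtain t where t: "t \<ge> 0" "g t = 0" using g(2) by (metis atLeast_iff imageE order_refl)
    with g_pos[of t] show ?thesis by force
  qed
  define C' where "C' = 2 ^ (?n + 1) * (C * (L * K))"
  have "C' \<ge> 0" using \<open>C \<ge> 0\<close> K L by (simp add: C'_def)
  have "mean_value_bound (2 ^ ?n * C') (\<lambda>x. g (f x)) \<Omega>"
  proof (rule mean_value_bound_if_cball)
    fix x :: 'a and R :: real
    assume R: "R > 0" "cball x R \<subseteq> \<Omega>"
    define w where "w = (\<lambda>y. g (f y))"
    \<comment> \<open>The weight is the distance to the boundary sphere, raised to the dimension. At
      the centre it equals \<open>R ^ ?n\<close>, so a bound for \<open>h\<close> there is the bound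
      sought.\<close>
    define h where "h = (\<lambda>y. w y * (R - dist x y) ^ ?n)"
    have sub: "ball x R \<subseteq> \<Omega>" using R ball_subset_cball by blast
    have f_nonneg: "f y \<ge> 0" and w_nonneg: "w y \<ge> 0" if "y \<in> ball x R" for y
      using that sub f(2) g_nonneg unfolding w_def by auto
    obtain b where b: "\<And>y. y \<in> cball x R \<Longrightarrow> f y \<le> b"
      using bdd[OF compact_cball R(2)] unfolding bdd_above_def by blast
    have h_le: "h y \<le> g b * R ^ ?n" if "y \<in> ball x R" for y
    proof -
      have "f y \<le> b" using that b[of y] by auto
      then have "w y \<le> g b" "0 \<le> g b"
        using f_nonneg[OF that] g_mono g_nonneg unfolding w_def by (auto simp: mono_on_def)
      moreover have "(R - dist x y) ^ ?n \<le> R ^ ?n" using that by (intro power_mono) auto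
      ultimately show ?thesis
        unfolding h_def using that by (intro mult_mono) auto
    qed
    then have bdd_h: "bdd_above (h ` ball x R)" by (rule bdd_aboveI2)
    define S where "S = (SUP y\<in>ball x R. h y)"
    have h_le_S: "h y \<le> S" if "y \<in> ball x R" for y
      unfolding S_def using that bdd_h by (rule cSUP_upper)
    have hx: "h x = w x * R ^ ?n" by (simp add: h_def)
    have "ennreal (w x * R ^ ?n) \<le> ennreal C' * (\<integral>\<^sup>+ y. ennreal (w y) \<partial>lebesgue_on (ball x R))"
    \<comment> \<open>Positivity makes \<open>S / 2 < S\<close> strict, which is what allows an
      almost maximising point to be chosen; otherwise the left-hand side vanishes in
      \<open>ennreal\<close>.\<close>
    proof (cases "w x > 0")
      case True
      then have "S > 0" using h_le_S[of x] hx R by (smt (verit) centre_in_ball mult_pos_pos zero_less_power)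
      then obtain y where y: "y \<in> ball x R" "S / 2 < h y"
        using less_cSUP_iff[OF _ bdd_h, of "S / 2"] R unfolding S_def[symmetric] by auto
      define s where "s = (R - dist x y) / 2"
      have s: "s > 0" "R - dist x y = 2 * s" using y by (auto simp: s_def)
      have hy: "h y = w y * 2 ^ ?n * s ^ ?n" by (simp add: h_def s power_mult_distrib)
      have "h y > 0" using y \<open>S > 0\<close> by simp
      then have wy: "w y > 0" using w_nonneg[OF y(1)] s by (simp add: hy zero_less_mult_iff)
      then have fy: "f y > 0" using f_nonneg[OF y(1)] g0 unfolding w_def by (cases "f y = 0") auto
      define B where "B = ball y s"
      have B_sub: "B \<subseteq> ball x R"
      proof
        fix z assume "z \<in> B"
        then show "z \<in> ball x R"
          using dist_triangle[of x z y] s by (auto simp: B_def dist_commute)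
      qed
      define c where "c = L * K * (f y / w y)"
      have c: "c \<ge> 0" using L K fy wy by (simp add: c_def)
      have f_le: "f z \<le> c * w z" if "z \<in> B" for z
      \<comment> \<open>The quasi-increasing condition concerns positive arguments only, so zeros of
        \<open>f\<close> are treated apart.\<close>
      proof (cases "f z = 0")
        case True
        have "w z \<ge> 0" using B_sub that by (intro w_nonneg) blast
        then show ?thesis using True c by simp
      next
        case False
        have z: "z \<in> ball x R" using B_sub that by blast
        have fz: "f z > 0" using False f_nonneg[OF z] by simp
        have wz: "w z > 0" using g_pos[OF fz] by (simp add: w_def)
        \<comment> \<open>The centre \<open>y\<close> is at distance \<open>2 * s\<close> from the
          sphere, so \<open>z\<close> keeps at least half of it. This bounds the weight at
          \<open>z\<close> from below.\<close>
        have "s \<le> R - dist x z"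
          using that s dist_triangle[of x z y] by (auto simp: B_def dist_commute)
        then have "w z * s ^ ?n \<le> h z"
          unfolding h_def using wz s by (intro mult_left_mono power_mono) auto
        also have "\<dots> \<le> 2 * h y" using h_le_S[OF z] y by simp
        also have "\<dots> = (2 ^ (?n + 1) * w y) * s ^ ?n" by (simp add: hy)
        finally have "w z \<le> 2 ^ (?n + 1) * w y" by (rule mult_right_le_imp_le) (use s in simp)
        then have "f z \<le> K * f y" using fz fy unfolding w_def by (intro K(2)) auto
        \<comment> \<open>Compare the quotients at \<open>f z\<close> and at \<open>K * f y\<close>;
          the denominator \<open>g (K * f y)\<close> may then be lowered to \<open>w y\<close>
          because \<open>K \<ge> 1\<close>.\<close>
        then have "f z / w z \<le> L * (K * f y / g (K * f y))"
          unfolding w_def using fz by (intro L(2)) auto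
        also have "\<dots> \<le> L * (K * f y / w y)"
        proof -
          have "f y \<le> K * f y" using K fy by simp
          then have "w y \<le> g (K * f y)"
            using g_mono fy unfolding w_def by (auto simp: mono_on_def)
          then show ?thesis using L K fy wy by (intro mult_left_mono divide_left_mono) auto
        qed
        also have "\<dots> = c" by (simp add: c_def)
        finally show ?thesis using pos_divide_le_eq[OF wz] by blast
      qed
      have w_meas: "w \<in> borel_measurable (lebesgue_on B)"
        unfolding w_def
      proof (rule measurable_comp_mono_on[OF g_mono])
        show "f \<in> borel_measurable (lebesgue_on B)"
          using measurable_restrict_mono[OF f(1)] B_sub sub by blast
      qed (use B_sub f_nonneg in auto)
      define J where "J = (\<integral>\<^sup>+ z. ennreal (w z) \<partial>lebesgue_on B)"
      have "B \<subseteq> \<Omega>" using B_sub sub by (rule order_trans)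
      then have "ennreal (f y * s ^ ?n) \<le> ennreal C * (\<integral>\<^sup>+ z. ennreal (f z) \<partial>lebesgue_on B)"
        using mvb s(1) unfolding mean_value_bound_def B_def by simp
      also have "\<dots> \<le> ennreal C * (\<integral>\<^sup>+ z. ennreal c * ennreal (w z) \<partial>lebesgue_on B)"
      proof (intro mult_left_mono nn_integral_mono)
        fix z assume "z \<in> space (lebesgue_on B)"
        then have "f z \<le> c * w z" by (intro f_le) simp
        then show "ennreal (f z) \<le> ennreal c * ennreal (w z)"
          using c by (metis ennreal_leI ennreal_mult')
      qed simp
      also have "\<dots> = ennreal C * (ennreal c * J)"
        unfolding J_def using w_meas by (subst nn_integral_cmult) auto
      finally have key: "ennreal (f y * s ^ ?n) \<le> ennreal (C * c) * J"
        using \<open>C \<ge> 0\<close> by (simp add: ennreal_mult' mult.assoc)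
      \<comment> \<open>The factor \<open>w y / f y\<close> produced here cancels
        \<open>f y / w y\<close> inside \<open>c\<close>, so the final constant \<open>C'\<close>
        depends neither on \<open>y\<close> nor on the ball.\<close>
      have "w x * R ^ ?n \<le> 2 * h y" using h_le_S[of x] R hx y by simp
      also have "\<dots> = (2 ^ (?n + 1) * (w y / f y)) * (f y * s ^ ?n)" using fy by (simp add: hy)
      finally have "ennreal (w x * R ^ ?n) \<le> ennreal (2 ^ (?n + 1) * (w y / f y)) * ennreal (f y * s ^ ?n)"
        using fy wy by (subst ennreal_mult'[symmetric]) (auto intro!: ennreal_leI)
      also have "\<dots> \<le> ennreal (2 ^ (?n + 1) * (w y / f y)) * (ennreal (C * c) * J)"
        using key by (rule mult_left_mono) simp
      also have "\<dots> = ennreal (2 ^ (?n + 1) * (w y / f y) * (C * c)) * J"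
        using fy wy by (subst ennreal_mult') (auto simp: mult.assoc)
      also have "2 ^ (?n + 1) * (w y / f y) * (C * c) = C'"
        using fy wy by (simp add: C'_def c_def)
      also have "ennreal C' * J \<le> ennreal C' * (\<integral>\<^sup>+ y. ennreal (w y) \<partial>lebesgue_on (ball x R))"
        unfolding J_def using B_sub
        by (intro mult_left_mono nn_integral_lebesgue_on_mono) (auto simp: B_def)
      finally show ?thesis .
    next
      case False
      then have "w x * R ^ ?n \<le> 0" using R by (simp add: mult_nonpos_nonneg)
      then show ?thesis by (simp add: ennreal_neg)
    qed
    then show "ennreal (g (f x) * R ^ ?n)
        \<le> ennreal C' * (\<integral>\<^sup>+ y. ennreal (g (f y)) \<partial>lebesgue_on (ball x R))"
      unfolding w_def .
  qed fact
  then show ?thesis by (rule that[rotated]) (use \<open>C' \<ge> 0\<close> in auto)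
qed

section \<open>Passage between extended real and real functions\<close>

lemma quasi_nearly_subharmonic_on_ereal_iff:
  fixes f :: "real^'n \<Rightarrow> real"
  assumes f: "\<And>x. x \<in> \<Omega> \<Longrightarrow> f x \<ge> 0"
  shows "quasi_nearly_subharmonic_on (\<lambda>x. ereal (f x)) \<Omega> \<longleftrightarrow>
    f \<in> borel_measurable (lebesgue_on \<Omega>) \<and>
    (\<forall>K. compact K \<and> K \<subseteq> \<Omega> \<longrightarrow> (\<integral>\<^sup>+ y. ennreal (f y) \<partial>lebesgue_on K) < \<infinity>) \<and>
    (\<exists>C\<ge>1. mean_value_bound C f \<Omega>)"
proof -
  have meas: "(\<lambda>x. ereal (f x)) \<in> borel_measurable (lebesgue_on \<Omega>)
      \<longleftrightarrow> f \<in> borel_measurable (lebesgue_on \<Omega>)"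
    by (rule borel_measurable_ereal_iff)
  have int: "(\<integral>\<^sup>+ y\<in>K. e2ennreal \<bar>ereal (f y)\<bar> \<partial>lebesgue) = (\<integral>\<^sup>+ y. ennreal (f y) \<partial>lebesgue_on K)"
    if "compact K" "K \<subseteq> \<Omega>" for K
  proof -
    have "K \<in> sets lebesgue" using that by (auto intro: lmeasurable_compact fmeasurableD)
    then show ?thesis
      using that f by (auto simp: nn_integral_restrict_space indicator_def subset_iff
          intro!: nn_integral_cong)
  qed
  have io: "integral_over (ball x r) (\<lambda>x. ereal (f x))
      = enn2ereal (\<integral>\<^sup>+ y. ennreal (f y) \<partial>lebesgue_on (ball x r))" if "ball x r \<subseteq> \<Omega>" for x r
  proof -
    \<comment> \<open>For nonnegative \<open>f\<close> the negative part vanishes on the ball, so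
      the difference defining \<open>integral_over\<close> reduces to its first term.\<close>
    have "(\<integral>\<^sup>+ y\<in>ball x r. e2ennreal (- ereal (f y)) \<partial>lebesgue) = (\<integral>\<^sup>+ y. 0 \<partial>(lebesgue :: (real^'n) measure))"
      by (intro nn_integral_cong)
        (use that f in \<open>auto simp: indicator_def subset_iff intro!: ennreal_neg\<close>)
    then show ?thesis
      unfolding integral_over_def by (simp add: nn_integral_restrict_space zero_ennreal.rep_eq)
  qed
  have bound: "ereal (f x) \<le> ereal (C / r ^ CARD('n)) * enn2ereal I
      \<longleftrightarrow> ennreal (f x * r ^ DIM(real^'n)) \<le> ennreal C * I"
    if "r > 0" "C \<ge> 1" "ball x r \<subseteq> \<Omega>" for x :: "real^'n" and r C :: real and I
  proof -
    have "f x \<ge> 0" using f that by (meson centre_in_ball subsetD)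
    then show ?thesis
      using that by (cases I)
        (auto simp: ennreal_mult_top field_simps simp flip: ennreal_mult)
  qed
  show ?thesis
    unfolding quasi_nearly_subharmonic_on_def locally_integrable_on_def mean_value_bound_def
    using meas int io bound by (smt (verit, best))
qed

lemma quasi_nearly_subharmonic_on_cong:
  assumes "\<And>x. x \<in> \<Omega> \<Longrightarrow> u x = v x"
  shows "quasi_nearly_subharmonic_on u \<Omega> \<longleftrightarrow> quasi_nearly_subharmonic_on v \<Omega>"
proof -
  have meas: "u \<in> borel_measurable (lebesgue_on \<Omega>) \<longleftrightarrow> v \<in> borel_measurable (lebesgue_on \<Omega>)"
    using assms by (intro measurable_cong) simp
  \<comment> \<open>One statement serves three integrands: \<open>F\<close> becomes the identity and
    negation for the two parts of the integral, and the absolute value for local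
    integrability.\<close>
  have int: "(\<integral>\<^sup>+ y\<in>A. e2ennreal (F (u y)) \<partial>lebesgue) = (\<integral>\<^sup>+ y\<in>A. e2ennreal (F (v y)) \<partial>lebesgue)"
    if "A \<subseteq> \<Omega>" for A and F :: "ereal \<Rightarrow> ereal"
    using that assms by (intro nn_integral_cong) (auto simp: indicator_def subset_iff)
  have io: "integral_over A u = integral_over A v" if "A \<subseteq> \<Omega>" for A
    unfolding integral_over_def using int[OF that, of "\<lambda>t. t"] int[OF that, of uminus] by simp
  have centre: "u x = v x" if "r > 0" "ball x r \<subseteq> \<Omega>" for x r
    using assms that by (meson centre_in_ball subsetD)
  show ?thesis
    unfolding quasi_nearly_subharmonic_on_def locally_integrable_on_def
    using meas int[of _ abs] io centre by (smt (verit, best))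
qed

section \<open>Assembly of the two compositions\<close>

theorem theorem2p5:
  fixes \<Omega> :: "(real^'n) set" and u :: "real^'n \<Rightarrow> ereal" and \<psi> :: "real \<Rightarrow> real"
  assumes "CARD('n) \<ge> 2"
    and "open \<Omega>" and "connected \<Omega>" and "\<Omega> \<noteq> {}" and "\<Omega> \<noteq> UNIV"
    and "\<forall>x\<in>\<Omega>. u x \<ge> 0"
    and "quasi_nearly_subharmonic_on u \<Omega>"
    and "\<psi> \<in> {0..} \<rightarrow> {0..}"
    and "permissible \<psi>"
  shows "quasi_nearly_subharmonic_on (\<lambda>x. ereal (\<psi> (real_of_ereal (u x)))) \<Omega>"
proof -
  define f where "f = (\<lambda>x. real_of_ereal (u x))"
  have f_nonneg: "f x \<ge> 0" if "x \<in> \<Omega>" for x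
    using assms(6) that by (simp add: f_def real_of_ereal_pos)
  \<comment> \<open>Finiteness of \<open>u\<close> on \<open>\<Omega>\<close> rules out the default
    value of \<open>real_of_ereal\<close> at infinity.\<close>
  have "u x = ereal (f x)" if "x \<in> \<Omega>" for x
    using quasi_nearly_subharmonic_on_finite[OF assms(7,2) that] assms(6) that
    unfolding f_def by (cases "u x") auto
  then have "quasi_nearly_subharmonic_on (\<lambda>x. ereal (f x)) \<Omega>"
    using assms(7) quasi_nearly_subharmonic_on_cong[of \<Omega> u "\<lambda>x. ereal (f x)"] by simp
  then have qns: "f \<in> borel_measurable (lebesgue_on \<Omega>) \<and>
    (\<forall>K. compact K \<and> K \<subseteq> \<Omega> \<longrightarrow> (\<integral>\<^sup>+ y. ennreal (f y) \<partial>lebesgue_on K) < \<infinity>) \<and>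
    (\<exists>C\<ge>1. mean_value_bound C f \<Omega>)"
    by (subst (asm) quasi_nearly_subharmonic_on_ereal_iff) (use f_nonneg in auto)
  then have f: "f \<in> borel_measurable (lebesgue_on \<Omega>)"
    and int: "\<And>K. compact K \<Longrightarrow> K \<subseteq> \<Omega> \<Longrightarrow> (\<integral>\<^sup>+ y. ennreal (f y) \<partial>lebesgue_on K) < \<infinity>"
    by blast+
  obtain C where C: "C \<ge> 1" "mean_value_bound C f \<Omega>" using qns by blast
  have bdd: "bdd_above (f ` K)" if "compact K" "K \<subseteq> \<Omega>" for K
    using mean_value_bound_locally_bounded[OF assms(2) C(2) int that] .
  obtain \<psi>\<^sub>1 \<psi>\<^sub>2 where
    \<psi>\<^sub>1: "\<psi>\<^sub>1 \<in> {0..} \<rightarrow> {0..}" "mono_on {0..} \<psi>\<^sub>1" "convex_on {0..} \<psi>\<^sub>1" "Delta2_condition \<psi>\<^sub>1"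
    and \<psi>\<^sub>2: "strict_mono_on {0..} \<psi>\<^sub>2" "\<psi>\<^sub>2 ` {0..} = {0..}"
      "Delta2_condition (inv_into {0..} \<psi>\<^sub>2)" "quasi_increasing (\<lambda>t. t / \<psi>\<^sub>2 t)"
    and \<psi>: "\<And>t. t \<ge> 0 \<Longrightarrow> \<psi> t = \<psi>\<^sub>2 (\<psi>\<^sub>1 t)"
    using assms(9) unfolding permissible_def by blast
  have mono_\<psi>\<^sub>2: "mono_on {0..} \<psi>\<^sub>2" using \<psi>\<^sub>2(1) by (rule strict_mono_on_imp_mono_on)
  define v where "v = (\<lambda>x. \<psi>\<^sub>1 (f x))"
  define w where "w = (\<lambda>x. \<psi>\<^sub>2 (v x))"
  have v_nonneg: "v x \<ge> 0" if "x \<in> \<Omega>" for x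
    using \<psi>\<^sub>1(1) f_nonneg[OF that] by (auto simp: v_def)
  have w_nonneg: "w x \<ge> 0" if "x \<in> \<Omega>" for x
    using \<psi>\<^sub>2(2) v_nonneg[OF that] by (auto simp: w_def)
  have v_meas: "v \<in> borel_measurable (lebesgue_on \<Omega>)"
    unfolding v_def by (rule measurable_comp_mono_on[OF \<psi>\<^sub>1(2) f]) (simp add: f_nonneg)
  have w_meas: "w \<in> borel_measurable (lebesgue_on \<Omega>)"
    unfolding w_def by (rule measurable_comp_mono_on[OF mono_\<psi>\<^sub>2 v_meas]) (simp add: v_nonneg)
  have bdd_comp: "bdd_above ((\<lambda>x. g (h x)) ` K)"
    if g: "mono_on {0..} g" and h: "\<And>x. x \<in> \<Omega> \<Longrightarrow> h x \<ge> 0" and K: "K \<subseteq> \<Omega>" "bdd_above (h ` K)"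
    for g :: "real \<Rightarrow> real" and h K
  proof -
    obtain b where b: "\<And>x. x \<in> K \<Longrightarrow> h x \<le> b" using K(2) by (auto simp: bdd_above_def)
    have "g (h x) \<le> g b" if "x \<in> K" for x
      using g h[of x] b[of x] that K(1) by (force simp: mono_on_def)
    then show ?thesis by (auto simp: bdd_above_def)
  qed
  \<comment> \<open>Local boundedness passes through both monotone maps: for \<open>v\<close> it
    feeds the second composition, for \<open>w\<close> it yields local integrability.\<close>
  have v_bdd: "bdd_above (v ` K)" if "compact K" "K \<subseteq> \<Omega>" for K
    unfolding v_def using bdd_comp[OF \<psi>\<^sub>1(2), of f] f_nonneg bdd that by simp
  have w_bdd: "bdd_above (w ` K)" if "compact K" "K \<subseteq> \<Omega>" for K
    unfolding w_def using bdd_comp[OF mono_\<psi>\<^sub>2, of v] v_nonneg v_bdd that by simp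
  obtain C\<^sub>1 where C\<^sub>1: "C\<^sub>1 \<ge> 0" "mean_value_bound C\<^sub>1 v \<Omega>"
    using mean_value_bound_convex[OF f f_nonneg bdd C(2) _ \<psi>\<^sub>1] C(1) unfolding v_def by auto
  obtain C\<^sub>2 where C\<^sub>2: "C\<^sub>2 \<ge> 0" "mean_value_bound C\<^sub>2 w \<Omega>"
    using mean_value_bound_quasi_increasing[OF v_meas v_nonneg v_bdd C\<^sub>1(2,1) \<psi>\<^sub>2]
    unfolding w_def by auto
  \<comment> \<open>The constant is raised to at least 1, as the definition of quasi-nearly
    subharmonic demands.\<close>
  have "mean_value_bound (max 1 C\<^sub>2) w \<Omega>"
    unfolding mean_value_bound_def
  proof (intro allI impI)
    fix x :: "real^'n" and r :: real
    assume "r > 0 \<and> ball x r \<subseteq> \<Omega>"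
    then have "ennreal (w x * r ^ DIM(real^'n))
        \<le> ennreal C\<^sub>2 * (\<integral>\<^sup>+ y. ennreal (w y) \<partial>lebesgue_on (ball x r))"
      using C\<^sub>2(2) unfolding mean_value_bound_def by blast
    also have "\<dots> \<le> ennreal (max 1 C\<^sub>2) * (\<integral>\<^sup>+ y. ennreal (w y) \<partial>lebesgue_on (ball x r))"
      by (intro mult_right_mono ennreal_leI) auto
    finally show "ennreal (w x * r ^ DIM(real^'n))
        \<le> ennreal (max 1 C\<^sub>2) * (\<integral>\<^sup>+ y. ennreal (w y) \<partial>lebesgue_on (ball x r))" .
  qed
  moreover have "(\<integral>\<^sup>+ y. ennreal (w y) \<partial>lebesgue_on K) < \<infinity>" if K: "compact K" "K \<subseteq> \<Omega>" for K
  proof -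
    obtain b where b: "\<And>x. x \<in> K \<Longrightarrow> w x \<le> b" using w_bdd[OF K] by (auto simp: bdd_above_def)
    have "(\<integral>\<^sup>+ y. ennreal (w y) \<partial>lebesgue_on K) \<le> (\<integral>\<^sup>+ y. ennreal b \<partial>lebesgue_on K)"
      using b by (intro nn_integral_mono ennreal_leI) auto
    also have "\<dots> = ennreal b * emeasure lebesgue K"
      using K lmeasurable_compact[of K]
      by (simp add: emeasure_restrict_space fmeasurableD)
    also have "\<dots> < \<infinity>"
      using fmeasurableD2[OF lmeasurable_compact[OF K(1)]]
      by (simp add: ennreal_mult_less_top less_top del: emeasure_completion)
    finally show ?thesis .
  qed
  ultimately have "quasi_nearly_subharmonic_on (\<lambda>x. ereal (w x)) \<Omega>"
    using w_meas w_nonneg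
    by (subst quasi_nearly_subharmonic_on_ereal_iff) (auto intro!: exI[of _ "max 1 C\<^sub>2"])
  moreover have "ereal (w x) = ereal (\<psi> (real_of_ereal (u x)))" if "x \<in> \<Omega>" for x
    using \<psi>[OF f_nonneg[OF that]] by (simp add: w_def v_def f_def)
  ultimately show ?thesis
    using quasi_nearly_subharmonic_on_cong[of \<Omega> "\<lambda>x. ereal (w x)"
        "\<lambda>x. ereal (\<psi> (real_of_ereal (u x)))"]
    by simp
qed

end
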